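(* Let $K$ be a field, let $P=K[a_0,a_1,\dots,a_n]$, let $d_1,\dots,d_n\in\mathbb N_+$ and $p_1,\dots,p_n\in\mathbb Z$, let $P$ be graded by an integer matrix $W$ whose first two rows are $W_1=(0\ d_1\ \cdots\ d_n)$ and $W_2=(1\ p_1\ \cdots\ p_n)$, and let $\sigma$ be a term ordering on $\mathbb T^{n+1}$ compatible with $W$ and of $a_0$-DegRev type. Let $S$ be a finitely generated $W$-graded $K$-subalgebra of $P$, let $a_0\in S$, let $\mathrm{SB}$ be a $\sigma$-SAGBI basis of $S$ consisting of $W$-homogeneous polynomials, let $d\in\mathbb N_+$, and let $\mathrm{SB}_{\le d}=\{g\in\mathrm{SB}\mid g \text{ is } W\text{-homogeneous and } \deg_{W_1}(g)\le d\}$. Then $$\{a_0\}\cup\{\,g:a_0^\infty\mid g\in \mathrm{SB}_{\le d}\,\}$$ is a $d$-truncated $\sigma$-SAGBI basis of $\mathrm{Sat}_{a_0}(S)$ (truncation with respect to $\deg_{W_1}$).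
   Context: $\mathbb T^{n+1}$ is the monoid of power products (terms) in $a_0,\dots,a_n$. The matrix $W\in\mathrm{Mat}_{m,n+1}(\mathbb Z)$ defines a $\mathbb Z^m$-grading on $P$ in which $\deg_W(a_j)$ is the column of $W$ indexed by $a_j$; $\deg_{W_1}$ is the grading given by the first row. A $K$-subalgebra is $W$-graded if it is generated by $W$-homogeneous elements. A term ordering $\sigma$ is compatible with $\deg_W$ if $\deg_W(t)>_{\mathrm{Lex}}\deg_W(t')$ implies $t>_\sigma t'$. It is of $a_0$-DegRev type (with respect to $W$) if it is compatible with $\deg_W$ and, whenever $t,t'\in\mathbb T^{n+1}$ satisfy $\deg_W(t)=\deg_W(t')$ and the exponent of $a_0$ in $t$ is strictly smaller than the exponent of $a_0$ in $t'$, one has $t>_\sigma t'$. $\mathrm{LT}_\sigma(f)$ is the leading term (a power product) of $f\neq0$. A (possibly infinite) set $G$ of non-zero elements of a $K$-subalgebra $A$ of $P$ is a $\sigma$-SAGBI basis of $A$ if the $K$-algebra generated by $\{\mathrm{LT}_\sigma(f)\mid f\in A\setminus\{0\}\}$ equals the $K$-algebra generated by $\{\mathrm{LT}_\sigma(g)\mid g\in G\}$. For a $W$-graded subalgebra $A$, a set $G$ of non-zero $W$-homogeneous elements of $A$ of $W_1$-degree $\le d$ is a $d$-truncated $\sigma$-SAGBI basis of $A$ if for every non-zero $W$-homogeneous $f\in A$ with $\deg_{W_1}(f)\le d$ the term $\mathrm{LT}_\sigma(f)$ is in the $K$-algebra generated by $\{\mathrm{LT}_\sigma(g)\mid g\in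 G\}$. For $0\ne f\in P$, $f:a_0^\infty$ is $f/a_0^i$, where $a_0^i$ is the highest power of $a_0$ dividing $f$. The saturation of $S$ with respect to $a_0$ is $\mathrm{Sat}_{a_0}(S)=S[a_0,a_0^{-1}]\cap P$. *)

theory Defs
  imports
    "HOL-Library.Poly_Mapping"
    "HOL-Computational_Algebra.Polynomial_Factorial"
    "Jordan_Normal_Form.Matrix"
begin

text \<open>
  The indeterminate \<open>a\<^sub>j\<close> is the natural number \<open>j\<close>; power products in finitely many
  of countably many indeterminates are finitely supported exponent functions, with addition of
  exponents as product. The power products and polynomials in \<open>a\<^sub>0, \<dots>, a\<^sub>n\<close> are the
  carrier sets \<open>terms n\<close> and \<open>polys n\<close>.
\<close>

type_synonym pprod = "nat \<Rightarrow>\<^sub>0 nat"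
type_synonym 'k mpoly = "pprod \<Rightarrow>\<^sub>0 'k"

definition terms :: "nat \<Rightarrow> pprod set" where
  "terms n = {t. Poly_Mapping.keys t \<subseteq> {..n}}"

definition polys :: "nat \<Rightarrow> 'k::field mpoly set" where
  "polys n = {f. Poly_Mapping.keys f \<subseteq> terms n}"

definition pp :: "pprod \<Rightarrow> 'k::field mpoly" where
  "pp t = Poly_Mapping.single t 1"

definition var :: "nat \<Rightarrow> 'k::field mpoly" where
  "var j = pp (Poly_Mapping.single j 1)"


subsection \<open>Subalgebras\<close>

text \<open>
  In the next definition \<open>C\<close> is the image of the base field in the ambient commutative ring;
  closure under negation follows from \<open>-1 \<in> C\<close>.
\<close>

definition subalg :: "'a::comm_ring_1 set \<Rightarrow> 'a set \<Rightarrow> bool" where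
  "subalg C A \<longleftrightarrow> C \<subseteq> A \<and> (\<forall>x\<in>A. \<forall>y\<in>A. x + y \<in> A \<and> x * y \<in> A)"

definition scalars :: "'k::field mpoly set" where
  "scalars = {Poly_Mapping.single 0 c | c. True}"

definition alg_gen :: "'k::field mpoly set \<Rightarrow> 'k mpoly set" where
  "alg_gen X = subalg scalars hull X"

definition subalgebra_of_polys :: "nat \<Rightarrow> 'k::field mpoly set \<Rightarrow> bool" where
  "subalgebra_of_polys n A \<longleftrightarrow> A \<subseteq> polys n \<and> subalg scalars A"

definition finitely_generated :: "'k::field mpoly set \<Rightarrow> bool" where
  "finitely_generated A \<longleftrightarrow> (\<exists>X. finite X \<and> A = alg_gen X)"


subsection \<open>Gradings\<close>

text \<open>Rows and columns are numbered from 0: \<open>W\<^sub>1\<close> is row 0, column \<open>j\<close> belongs to \<open>a\<^sub>j\<close>.\<close>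

definition deg_pp :: "int mat \<Rightarrow> pprod \<Rightarrow> int vec" where
  "deg_pp W t = W *\<^sub>v vec (dim_col W) (\<lambda>j. int (Poly_Mapping.lookup t j))"

definition homogeneous :: "int mat \<Rightarrow> 'k::field mpoly \<Rightarrow> bool" where
  "homogeneous W f \<longleftrightarrow>
     (\<forall>t\<in>Poly_Mapping.keys f. \<forall>t'\<in>Poly_Mapping.keys f. deg_pp W t = deg_pp W t')"

text \<open>Only meaningful for non-zero polynomials.\<close>

definition deg_row1 :: "int mat \<Rightarrow> 'k::field mpoly \<Rightarrow> int" where
  "deg_row1 W f = Max ((\<lambda>t. deg_pp W t $ 0) ` Poly_Mapping.keys f)"

definition graded_subalgebra :: "nat \<Rightarrow> int mat \<Rightarrow> 'k::field mpoly set \<Rightarrow> bool" where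
  "graded_subalgebra n W A \<longleftrightarrow>
     (\<exists>X \<subseteq> polys n. (\<forall>f\<in>X. homogeneous W f) \<and> A = alg_gen X)"


subsection \<open>Term orderings\<close>

text \<open>Orderings are reflexive relations: \<open>(s, t) \<in> \<sigma>\<close> means that \<open>s\<close> is at most \<open>t\<close>.\<close>

definition term_ordering :: "nat \<Rightarrow> pprod rel \<Rightarrow> bool" where
  "term_ordering n \<sigma> \<longleftrightarrow> linear_order_on (terms n) \<sigma>
     \<and> (\<forall>t\<in>terms n. (0, t) \<in> \<sigma>)
     \<and> (\<forall>s t u. (s, t) \<in> \<sigma> \<and> u \<in> terms n \<longrightarrow> (s + u, t + u) \<in> \<sigma>)"

definition term_gt :: "pprod rel \<Rightarrow> pprod \<Rightarrow> pprod \<Rightarrow> bool" where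
  "term_gt \<sigma> t t' \<longleftrightarrow> (t', t) \<in> \<sigma> \<and> t \<noteq> t'"

definition lex_gt :: "int vec \<Rightarrow> int vec \<Rightarrow> bool" where
  "lex_gt u v \<longleftrightarrow> (\<exists>i < dim_vec u. u $ i > v $ i \<and> (\<forall>k<i. u $ k = v $ k))"

definition compatible :: "nat \<Rightarrow> int mat \<Rightarrow> pprod rel \<Rightarrow> bool" where
  "compatible n W \<sigma> \<longleftrightarrow>
     (\<forall>t\<in>terms n. \<forall>t'\<in>terms n. lex_gt (deg_pp W t) (deg_pp W t') \<longrightarrow> term_gt \<sigma> t t')"

definition a0_DegRev_type :: "nat \<Rightarrow> int mat \<Rightarrow> pprod rel \<Rightarrow> bool" where
  "a0_DegRev_type n W \<sigma> \<longleftrightarrow> compatible n W \<sigma>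
     \<and> (\<forall>t\<in>terms n. \<forall>t'\<in>terms n. deg_pp W t = deg_pp W t'
           \<and> Poly_Mapping.lookup t 0 < Poly_Mapping.lookup t' 0 \<longrightarrow> term_gt \<sigma> t t')"

definition LT :: "pprod rel \<Rightarrow> 'k::field mpoly \<Rightarrow> pprod" where
  "LT \<sigma> f = (THE t. t \<in> Poly_Mapping.keys f \<and> (\<forall>s\<in>Poly_Mapping.keys f. (s, t) \<in> \<sigma>))"


subsection \<open>SAGBI bases\<close>

definition LT_alg :: "pprod rel \<Rightarrow> 'k::field mpoly set \<Rightarrow> 'k mpoly set" where
  "LT_alg \<sigma> G = alg_gen {pp (LT \<sigma> g) | g. g \<in> G}"

definition sagbi_basis ::
    "nat \<Rightarrow> pprod rel \<Rightarrow> 'k::field mpoly set \<Rightarrow> 'k mpoly set \<Rightarrow> bool" where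
  "sagbi_basis n \<sigma> A G \<longleftrightarrow> subalgebra_of_polys n A \<and> G \<subseteq> A - {0}
     \<and> LT_alg \<sigma> (A - {0}) = LT_alg \<sigma> G"

text \<open>Being a truncated basis of \<open>A\<close> includes that \<open>A\<close> is a graded subalgebra.\<close>

definition truncated_sagbi_basis ::
    "nat \<Rightarrow> int mat \<Rightarrow> pprod rel \<Rightarrow> nat \<Rightarrow> 'k::field mpoly set \<Rightarrow> 'k mpoly set \<Rightarrow> bool" where
  "truncated_sagbi_basis n W \<sigma> d A G \<longleftrightarrow> graded_subalgebra n W A
     \<and> G \<subseteq> A - {0}
     \<and> (\<forall>g\<in>G. homogeneous W g \<and> deg_row1 W g \<le> int d)
     \<and> (\<forall>f\<in>A - {0}. homogeneous W f \<and> deg_row1 W f \<le> int d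
           \<longrightarrow> pp (LT \<sigma> f) \<in> LT_alg \<sigma> G)"


subsection \<open>Saturation with respect to a0\<close>

definition a0_power :: "'k::field mpoly \<Rightarrow> nat" where
  "a0_power f = (GREATEST i. var 0 ^ i dvd f)"

text \<open>\<open>f : a\<^sub>0\<^sup>\<infinity>\<close>, for non-zero \<open>f\<close>\<close>

definition colon_a0 :: "'k::field mpoly \<Rightarrow> 'k mpoly" where
  "colon_a0 f = (THE g. f = var 0 ^ a0_power f * g)"

text \<open>
  The algebra \<open>S[a\<^sub>0, a\<^sub>0\<^sup>-\<^sup>1]\<close> is formed inside the field of fractions, into which
  polynomials embed by \<open>to_fract\<close>.
\<close>

definition localized_alg :: "'k::field mpoly set \<Rightarrow> 'k mpoly fract set" where
  "localized_alg S = subalg (to_fract ` scalars) hull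
     (to_fract ` S \<union> {to_fract (var 0), inverse (to_fract (var 0))})"

definition saturation :: "nat \<Rightarrow> 'k::field mpoly set \<Rightarrow> 'k mpoly set" where
  "saturation n S = {f \<in> polys n. to_fract f \<in> localized_alg S}"

end

theory Submission
  imports Defs
begin

text \<open>
  An element of \<open>Sat\<^bsub>a\<^sub>0\<^esub>(S)\<close> is a polynomial \<open>f\<close> with \<open>a\<^sub>0\<^sup>k f \<in> S\<close> for some \<open>k\<close>
  (\<open>saturation_iff\<close>). Since multiplication by \<open>a\<^sub>0\<^sup>k\<close> only shifts degrees, the homogeneous
  components of \<open>f\<close> are again in the saturation (\<open>component_in_saturation\<close>), so the saturation
  is graded.

  Let \<open>f\<close> be a non-zero homogeneous element of the saturation of \<open>W\<^sub>1\<close>-degree at most \<open>d\<close>, and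
  let \<open>a\<^sub>0\<^sup>k f \<in> S\<close>. The term \<open>a\<^sub>0\<^sup>k LT(f) = LT(a\<^sub>0\<^sup>k f)\<close> lies in the leading term algebra of
  \<open>S\<close>, which is spanned by terms, and so it is a product of terms \<open>LT(g)\<close> with \<open>g \<in> SB\<close>
  (\<open>pp_in_alg_gen_imp\<close>). As \<open>a\<^sub>0\<close> has \<open>W\<^sub>1\<close>-degree \<open>0\<close> and no term has negative
  \<open>W\<^sub>1\<close>-degree, all these \<open>g\<close> have \<open>W\<^sub>1\<close>-degree at most \<open>d\<close>.

  Write \<open>g = a\<^sub>0\<^sup>i g'\<close> with \<open>g' = g : a\<^sub>0\<^sup>\<infinity>\<close>. Then \<open>LT(g) = a\<^sub>0\<^sup>i LT(g')\<close>. Some term of \<open>g'\<close> is not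
  divisible by \<open>a\<^sub>0\<close>, and \<open>g'\<close> is homogeneous, so for an ordering of \<open>a\<^sub>0\<close>-DegRev type \<open>LT(g')\<close> is
  not divisible by \<open>a\<^sub>0\<close> either (\<open>LT_not_divisible_a0\<close>). Hence \<open>a\<^sub>0\<^sup>k LT(f) = a\<^sub>0\<^sup>e s\<close>, where \<open>s\<close> is
  a product of terms \<open>LT(g')\<close> and prime to \<open>a\<^sub>0\<close>. Comparing exponents of \<open>a\<^sub>0\<close> gives \<open>k \<le> e\<close>, and
  \<open>LT(f) = a\<^sub>0\<^sup>e\<^sup>-\<^sup>k s\<close> is a product of leading terms of the proposed truncated basis.
\<close>

section \<open>Products with power products\<close>

lemma pp_0: "pp 0 = (1 :: 'k::field mpoly)"
  by (simp add: pp_def)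

lemma pp_add: "pp (s + t) = (pp s * pp t :: 'k::field mpoly)"
  by (simp add: pp_def mult_single)

lemma var_power: "var j ^ k = (pp (Poly_Mapping.single j k) :: 'k::field mpoly)"
proof (induction k)
  case (Suc k)
  have "Poly_Mapping.single j (Suc k) = Poly_Mapping.single j 1 + Poly_Mapping.single j k"
    by (simp flip: single_add)
  then show ?case using Suc by (simp add: var_def pp_add)
qed (simp add: pp_0)

lemma mpoly_as_sum:
  fixes f :: "'k::field mpoly"
  shows "f = (\<Sum>t\<in>Poly_Mapping.keys f. Poly_Mapping.single t (Poly_Mapping.lookup f t))"
proof (rule poly_mapping_eqI)
  fix x
  show "Poly_Mapping.lookup f x = Poly_Mapping.lookup
      (\<Sum>t\<in>Poly_Mapping.keys f. Poly_Mapping.single t (Poly_Mapping.lookup f t)) x"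
    by (simp add: lookup_sum lookup_single when_def in_keys_iff)
qed

lemma lookup_pp_times_add:
  fixes f :: "'k::field mpoly"
  shows "Poly_Mapping.lookup (pp u * f) (u + t) = Poly_Mapping.lookup f t"
proof -
  have "pp u * f = (\<Sum>t\<in>Poly_Mapping.keys f. Poly_Mapping.single (u + t) (Poly_Mapping.lookup f t))"
    by (subst mpoly_as_sum[of f]) (simp add: sum_distrib_left pp_def mult_single)
  then show ?thesis by (simp add: lookup_sum lookup_single when_def in_keys_iff)
qed

lemma keys_pp_times:
  fixes f :: "'k::field mpoly"
  shows "Poly_Mapping.keys (pp u * f) = (+) u ` Poly_Mapping.keys f"
proof
  show "Poly_Mapping.keys (pp u * f) \<subseteq> (+) u ` Poly_Mapping.keys f"
    using keys_mult[of "pp u" f] by (auto simp: pp_def)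
  show "(+) u ` Poly_Mapping.keys f \<subseteq> Poly_Mapping.keys (pp u * f)"
    by (auto simp: in_keys_iff lookup_pp_times_add)
qed

lemma keys_empty_iff: "Poly_Mapping.keys (f :: 'k::field mpoly) = {} \<longleftrightarrow> f = 0"
  by (metis mpoly_as_sum sum.empty keys_zero)

lemma pp_neq_0: "pp u \<noteq> (0 :: 'k::field mpoly)"
  by (metis empty_not_insert keys_single keys_zero pp_def zero_neq_one)

lemma var_neq_0: "var j \<noteq> (0 :: 'k::field mpoly)"
  by (simp add: var_def pp_neq_0)

lemma terms_0: "0 \<in> terms n"
  by (simp add: terms_def)

lemma terms_single_0: "Poly_Mapping.single 0 k \<in> terms n"
  by (simp add: terms_def)

lemma terms_add: "s \<in> terms n \<Longrightarrow> t \<in> terms n \<Longrightarrow> s + t \<in> terms n"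
  using keys_add[of s t] by (auto simp: terms_def)

lemma terms_add_cancel: "s + t \<in> terms n \<Longrightarrow> t \<in> terms n"
  by (auto simp: terms_def in_keys_iff lookup_add subset_iff)

lemma polys_scalar: "scalars \<subseteq> polys n"
  by (auto simp: scalars_def polys_def terms_0 split: if_splits)

lemma polys_add: "f \<in> polys n \<Longrightarrow> g \<in> polys n \<Longrightarrow> f + g \<in> polys n"
  using keys_add[of f g] by (auto simp: polys_def)

lemma polys_mult: "f \<in> polys n \<Longrightarrow> g \<in> polys n \<Longrightarrow> f * g \<in> polys n"
  using keys_mult[of f g] terms_add[of _ n] unfolding polys_def by blast

lemma polys_pp_times_cancel: "pp u * g \<in> polys n \<Longrightarrow> g \<in> polys n"
  by (auto simp: polys_def keys_pp_times intro: terms_add_cancel)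

lemma var0_in_polys: "var 0 \<in> polys n"
  by (simp add: polys_def var_def pp_def terms_single_0)


section \<open>Subalgebras and additive spans\<close>

lemma subalg_subalg_hull: "subalg C (subalg C hull X)"
  by (rule hull_in) (auto simp: subalg_def)

lemma subalg_alg_gen: "subalg scalars (alg_gen X)"
  unfolding alg_gen_def by (rule subalg_subalg_hull)

lemma subalg_const: "subalg C A \<Longrightarrow> x \<in> C \<Longrightarrow> x \<in> A"
  by (auto simp: subalg_def)

lemma subalg_add: "subalg C A \<Longrightarrow> x \<in> A \<Longrightarrow> y \<in> A \<Longrightarrow> x + y \<in> A"
  by (simp add: subalg_def)

lemma subalg_mult: "subalg C A \<Longrightarrow> x \<in> A \<Longrightarrow> y \<in> A \<Longrightarrow> x * y \<in> A"
  by (simp add: subalg_def)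

lemma subalg_power: "subalg C A \<Longrightarrow> 1 \<in> C \<Longrightarrow> x \<in> A \<Longrightarrow> x ^ k \<in> A"
  by (induction k) (simp_all add: subalg_const subalg_mult)

lemma one_in_scalars: "1 \<in> scalars"
  unfolding scalars_def by (rule CollectI, rule exI[of _ 1]) simp

lemma zero_in_scalars: "0 \<in> scalars"
  unfolding scalars_def by (rule CollectI, rule exI[of _ 0]) simp

lemma subalg_sum:
  assumes "subalg scalars A" "\<And>i. i \<in> I \<Longrightarrow> f i \<in> A"
  shows "sum f I \<in> A"
  using assms(2)
  by (induction I rule: infinite_finite_induct)
    (simp_all add: subalg_add[OF assms(1)] subalg_const[OF assms(1) zero_in_scalars])

text \<open>
  The additive submonoid generated by \<open>H\<close>. It is used for the sums of homogeneous elements of a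
  subalgebra, and for the submonoid of power products generated by given terms.
\<close>

inductive_set add_span :: "'a::comm_monoid_add set \<Rightarrow> 'a set" for H :: "'a set" where
  zero: "0 \<in> add_span H"
| add: "h \<in> H \<Longrightarrow> x \<in> add_span H \<Longrightarrow> h + x \<in> add_span H"

lemma add_span_inc: "h \<in> H \<Longrightarrow> h \<in> add_span H"
  using add_span.add[OF _ add_span.zero] by fastforce

lemma add_span_add: "x \<in> add_span H \<Longrightarrow> y \<in> add_span H \<Longrightarrow> x + y \<in> add_span H"
  by (induction rule: add_span.induct) (auto simp: add.assoc intro: add_span.intros)

lemma add_span_mult:
  fixes H :: "'a::comm_ring_1 set"
  assumes H: "\<And>a b. a \<in> H \<Longrightarrow> b \<in> H \<Longrightarrow> a * b \<in> H"
    and x: "x \<in> add_span H" and y: "y \<in> add_span H"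
  shows "x * y \<in> add_span H"
  using x
proof (induction rule: add_span.induct)
  case (add h x)
  have "h * y \<in> add_span H"
    using y by (induction rule: add_span.induct)
      (auto simp: distrib_left intro: add_span.intros H add.hyps)
  then show ?case using add.IH by (auto simp: distrib_right intro: add_span_add)
qed (simp add: add_span.zero)

text \<open>An algebra generated by terms contains no other terms than products of the generators.\<close>

lemma pp_in_alg_gen_imp:
  assumes "pp t \<in> alg_gen (pp ` M :: 'k::field mpoly set)"
  shows "t \<in> add_span M"
proof -
  let ?T = "{f :: 'k mpoly. Poly_Mapping.keys f \<subseteq> add_span M}"
  have "subalg scalars ?T"
    unfolding subalg_def
  proof (intro conjI ballI)
    show "scalars \<subseteq> ?T" by (auto simp: scalars_def add_span.zero split: if_splits)
    fix f g assume fg: "f \<in> ?T" "g \<in> ?T"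
    show "f + g \<in> ?T" using fg keys_add[of f g] by auto
    show "f * g \<in> ?T" using fg keys_mult[of f g] add_span_add[of _ M] by blast
  qed
  moreover have "pp ` M \<subseteq> ?T" by (auto simp: pp_def add_span_inc)
  ultimately have "alg_gen (pp ` M) \<subseteq> ?T" unfolding alg_gen_def by (rule hull_minimal[rotated])
  with assms show ?thesis by (auto simp: pp_def)
qed


section \<open>Homogeneous components\<close>

lemma deg_pp_add: "deg_pp W (s + t) = deg_pp W s + deg_pp W t"
proof -
  have *: "vec (dim_col W) (\<lambda>j. int (Poly_Mapping.lookup (s + t) j))
      = vec (dim_col W) (\<lambda>j. int (Poly_Mapping.lookup s j))
        + vec (dim_col W) (\<lambda>j. int (Poly_Mapping.lookup t j))"
    by (rule eq_vecI) (auto simp: lookup_add)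
  show ?thesis unfolding deg_pp_def *
    by (rule mult_add_distrib_mat_vec[of _ "dim_row W" "dim_col W"]) auto
qed

lemma deg_pp_dim [simp]: "dim_vec (deg_pp W t) = dim_row W"
  by (simp add: deg_pp_def)

lemma deg_pp_add_left_iff: "deg_pp W (u + s) = deg_pp W (u + t) \<longleftrightarrow> deg_pp W s = deg_pp W t"
  unfolding deg_pp_add by (auto simp: vec_eq_iff)

lemma homogeneous_mult:
  assumes "homogeneous W f" "homogeneous W g"
  shows "homogeneous W (f * g)"
  unfolding homogeneous_def
proof (intro ballI)
  fix t t' assume "t \<in> Poly_Mapping.keys (f * g)" "t' \<in> Poly_Mapping.keys (f * g)"
  then obtain a b a' b' where "t = a + b" "t' = a' + b'"
    "a \<in> Poly_Mapping.keys f" "a' \<in> Poly_Mapping.keys f"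
    "b \<in> Poly_Mapping.keys g" "b' \<in> Poly_Mapping.keys g"
    using keys_mult[of f g] by blast
  with assms show "deg_pp W t = deg_pp W t'"
    unfolding homogeneous_def by (metis deg_pp_add)
qed

lemma homogeneous_pp_times_iff: "homogeneous W (pp u * f) \<longleftrightarrow> homogeneous W f"
  by (simp add: homogeneous_def keys_pp_times deg_pp_add_left_iff)

lemma homogeneous_pp: "homogeneous W (pp u)"
  by (simp add: homogeneous_def pp_def)

text \<open>The homogeneous component of \<open>f\<close> of degree \<open>v\<close>.\<close>

definition component :: "int mat \<Rightarrow> int vec \<Rightarrow> 'k::field mpoly \<Rightarrow> 'k mpoly" where
  "component W v f = (\<Sum>t\<in>{t \<in> Poly_Mapping.keys f. deg_pp W t = v}.
     Poly_Mapping.single t (Poly_Mapping.lookup f t))"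

lemma lookup_component:
  "Poly_Mapping.lookup (component W v f) t = (if deg_pp W t = v then Poly_Mapping.lookup f t else 0)"
  by (auto simp: component_def lookup_sum lookup_single when_def in_keys_iff)

lemma keys_component: "Poly_Mapping.keys (component W v f) = {t \<in> Poly_Mapping.keys f. deg_pp W t = v}"
  by (auto simp: in_keys_iff lookup_component split: if_splits)

lemma component_0: "component W v 0 = 0"
  by (simp add: component_def)

lemma component_add: "component W v (f + g) = component W v f + component W v g"
  by (rule poly_mapping_eqI) (simp add: lookup_component lookup_add)

lemma component_homogeneous:
  assumes "homogeneous W f"
  shows "component W v f = f \<or> component W v f = 0"
proof (cases "\<exists>t\<in>Poly_Mapping.keys f. deg_pp W t = v")
  case True
  then have "deg_pp W s = v" if "s \<in> Poly_Mapping.keys f" for s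
    using that assms unfolding homogeneous_def by blast
  then have "component W v f = f"
    by (intro poly_mapping_eqI) (auto simp: lookup_component in_keys_iff)
  then show ?thesis ..
next
  case False
  then have "component W v f = 0"
    by (intro poly_mapping_eqI) (auto simp: lookup_component in_keys_iff)
  then show ?thesis ..
qed

lemma homogeneous_component: "homogeneous W (component W v f)"
  by (simp add: homogeneous_def keys_component)

lemma component_pp_times:
  "component W (deg_pp W (u + t)) (pp u * f) = pp u * component W (deg_pp W t) f"
proof (rule poly_mapping_eqI)
  fix x
  show "Poly_Mapping.lookup (component W (deg_pp W (u + t)) (pp u * f)) x
      = Poly_Mapping.lookup (pp u * component W (deg_pp W t) f) x"
  proof (cases "x \<in> range ((+) u)")
    case True
    then obtain s where "x = u + s" by auto
    then show ?thesis by (simp add: lookup_component lookup_pp_times_add deg_pp_add_left_iff)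
  next
    case False
    then have "x \<notin> Poly_Mapping.keys (pp u * h)" for h :: "'a mpoly"
      by (auto simp: keys_pp_times)
    then show ?thesis by (simp add: lookup_component in_keys_iff)
  qed
qed

lemma sum_components: "f = (\<Sum>v\<in>deg_pp W ` Poly_Mapping.keys f. component W v f)"
proof -
  have "f = (\<Sum>t\<in>Poly_Mapping.keys f. Poly_Mapping.single t (Poly_Mapping.lookup f t))"
    by (rule mpoly_as_sum)
  also have "\<dots> = (\<Sum>v\<in>deg_pp W ` Poly_Mapping.keys f. component W v f)"
    unfolding component_def by (rule sum.image_gen) simp
  finally show ?thesis .
qed

lemma graded_subalgebra_subalg: "graded_subalgebra n W A \<Longrightarrow> subalg scalars A"
  unfolding graded_subalgebra_def using subalg_alg_gen by blast

text \<open>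
  A subalgebra generated by homogeneous elements is a graded subspace: products of homogeneous
  elements are homogeneous, so the sums of homogeneous elements already form a subalgebra.
\<close>

lemma component_in_graded_subalgebra:
  fixes A :: "'k::field mpoly set"
  assumes A: "graded_subalgebra n W A" and f: "f \<in> A"
  shows "component W v f \<in> A"
proof -
  obtain X where X: "\<And>f. f \<in> X \<Longrightarrow> homogeneous W f" and A_eq: "A = alg_gen X"
    using A by (auto simp: graded_subalgebra_def)
  have sub: "subalg scalars A" by (rule graded_subalgebra_subalg[OF A])
  define H where "H = {h \<in> A. homogeneous W h}"
  have "subalg scalars (add_span H)"
    unfolding subalg_def
  proof (intro conjI ballI)
    have "scalars \<subseteq> H"
      using subalg_const[OF sub]
      by (auto simp: H_def scalars_def homogeneous_def split: if_splits)
    then show "scalars \<subseteq> add_span H" using add_span_inc by blast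
    fix x y assume xy: "x \<in> add_span H" "y \<in> add_span H"
    then show "x + y \<in> add_span H" by (rule add_span_add)
    have "a * b \<in> H" if "a \<in> H" "b \<in> H" for a b
      using that by (simp add: H_def homogeneous_mult subalg_mult[OF sub])
    then show "x * y \<in> add_span H" using xy by (rule add_span_mult)
  qed
  moreover have "X \<subseteq> add_span H"
    using X by (auto simp: A_eq H_def alg_gen_def intro!: add_span_inc hull_inc)
  ultimately have "A \<subseteq> add_span H"
    unfolding A_eq alg_gen_def by (rule hull_minimal[rotated])
  with f have "f \<in> add_span H" by blast
  then show ?thesis
  proof (induction rule: add_span.induct)
    case zero
    show ?case by (simp add: component_0 subalg_const[OF sub zero_in_scalars])
  next
    case (add h x)
    then have "component W v h \<in> A"
      using component_homogeneous[of W h v] subalg_const[OF sub zero_in_scalars]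
      by (auto simp: H_def)
    with add.IH show ?case by (simp add: component_add subalg_add[OF sub])
  qed
qed


section \<open>The saturation\<close>

lemma to_fract_power: "to_fract (x ^ k) = to_fract x ^ k"
  by (induction k) auto

text \<open>
  Since \<open>a\<^sub>0 \<in> S\<close>, the algebra \<open>S[a\<^sub>0, a\<^sub>0\<^sup>-\<^sup>1]\<close> consists of the fractions \<open>s / a\<^sub>0\<^sup>k\<close> with \<open>s \<in> S\<close>.
\<close>

lemma saturation_iff:
  fixes S :: "'k::field mpoly set"
  assumes S: "subalg scalars S" and a0: "var 0 \<in> S"
  shows "f \<in> saturation n S \<longleftrightarrow> f \<in> polys n \<and> (\<exists>k. var 0 ^ k * f \<in> S)"
proof -
  let ?a = "to_fract (var 0 :: 'k mpoly)"
  have pow: "var 0 ^ k \<in> S" for k using subalg_power[OF S one_in_scalars a0] .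
  have Sadd: "x + y \<in> S" and Smult: "x * y \<in> S" if "x \<in> S" "y \<in> S" for x y
    using that subalg_add[OF S] subalg_mult[OF S] by auto
  have a_nz: "?a \<noteq> 0" by (simp add: var_neq_0)
  \<comment> \<open>The fractions with numerator in \<open>S\<close> and a power of \<open>a\<^sub>0\<close> as denominator\<close>
  define T where "T = {x. \<exists>k. \<exists>s\<in>S. x * ?a ^ k = to_fract s}"
  have "subalg (to_fract ` scalars) T"
    unfolding subalg_def
  proof (intro conjI ballI)
    show "to_fract ` scalars \<subseteq> T"
    proof
      fix x assume "x \<in> to_fract ` (scalars :: 'k mpoly set)"
      then obtain s where s: "s \<in> S" "x = to_fract s" using subalg_const[OF S] by auto
      then have "x * ?a ^ 0 = to_fract s" by simp
      with s show "x \<in> T" unfolding T_def by blast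
    qed
    fix x y assume "x \<in> T" "y \<in> T"
    then obtain k s l r where s: "s \<in> S" "x * ?a ^ k = to_fract s"
      and r: "r \<in> S" "y * ?a ^ l = to_fract r"
      by (auto simp: T_def)
    have "(x + y) * ?a ^ (k + l) = (x * ?a ^ k) * ?a ^ l + (y * ?a ^ l) * ?a ^ k"
      by (simp only: power_add distrib_right mult.assoc mult.commute mult.left_commute)
    also have "\<dots> = to_fract (s * var 0 ^ l + r * var 0 ^ k)"
      by (simp only: s r to_fract_add to_fract_mult to_fract_power)
    finally have eq: "(x + y) * ?a ^ (k + l) = to_fract (s * var 0 ^ l + r * var 0 ^ k)" .
    have "s * var 0 ^ l + r * var 0 ^ k \<in> S"
      by (intro Sadd Smult s r pow)
    with eq show "x + y \<in> T" unfolding T_def by blast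
    have "(x * y) * ?a ^ (k + l) = (x * ?a ^ k) * (y * ?a ^ l)"
      by (simp only: power_add mult.assoc mult.commute mult.left_commute)
    also have "\<dots> = to_fract (s * r)" by (simp only: s r to_fract_mult)
    finally show "x * y \<in> T" unfolding T_def using Smult[OF s(1) r(1)] by blast
  qed
  moreover have "to_fract ` S \<union> {?a, inverse ?a} \<subseteq> T"
  proof -
    have "to_fract s * ?a ^ 0 = to_fract s" for s by simp
    then have *: "to_fract s \<in> T" if "s \<in> S" for s unfolding T_def using that by blast
    have "inverse ?a * ?a ^ 1 = to_fract 1" using a_nz by simp
    moreover have "1 \<in> S" using subalg_const[OF S one_in_scalars] .
    ultimately have "inverse ?a \<in> T" unfolding T_def by blast
    then show ?thesis using *[OF a0] * by blast
  qed
  ultimately have loc: "localized_alg S \<subseteq> T"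
    unfolding localized_alg_def by (rule hull_minimal[rotated])
  have "\<exists>k. var 0 ^ k * f \<in> S" if loc_f: "to_fract f \<in> localized_alg S"
  proof -
    obtain k s where s: "s \<in> S" "to_fract f * ?a ^ k = to_fract s"
      using loc loc_f by (auto simp: T_def)
    then have "to_fract (var 0 ^ k * f) = to_fract s"
      by (simp only: to_fract_mult to_fract_power mult.commute)
    then have "var 0 ^ k * f = s" by (simp only: to_fract_eq_iff)
    with s show ?thesis by blast
  qed
  moreover have "to_fract f \<in> localized_alg S" if "var 0 ^ k * f \<in> S" for k
  proof -
    have sub: "subalg (to_fract ` scalars) (localized_alg S)"
      unfolding localized_alg_def by (rule subalg_subalg_hull)
    have "1 \<in> to_fract ` (scalars :: 'k mpoly set)"
      using one_in_scalars by (metis image_eqI to_fract_1)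
    moreover have "inverse ?a \<in> localized_alg S"
      unfolding localized_alg_def by (rule hull_inc) (rule UnI2, rule insertI2, rule singletonI)
    ultimately have "inverse ?a ^ k \<in> localized_alg S" by (rule subalg_power[OF sub])
    moreover have "to_fract (var 0 ^ k * f) \<in> localized_alg S"
      unfolding localized_alg_def using that by (intro hull_inc UnI1 imageI)
    ultimately have "inverse ?a ^ k * to_fract (var 0 ^ k * f) \<in> localized_alg S"
      by (rule subalg_mult[OF sub])
    moreover have "inverse ?a ^ k * to_fract (var 0 ^ k * f) = (inverse ?a * ?a) ^ k * to_fract f"
      by (simp only: to_fract_mult to_fract_power power_mult_distrib mult.assoc)
    then have "inverse ?a ^ k * to_fract (var 0 ^ k * f) = to_fract f"
      by (simp only: left_inverse[OF a_nz] power_one mult_1_left)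
    ultimately show ?thesis by (simp only:)
  qed
  ultimately show ?thesis by (auto simp: saturation_def)
qed

lemma subalg_saturation: "subalg scalars (saturation n S)"
proof -
  have "subalg (to_fract ` scalars) (localized_alg S)"
    unfolding localized_alg_def by (rule subalg_subalg_hull)
  note * = subalg_const[OF this] subalg_add[OF this] subalg_mult[OF this]
  show ?thesis
    unfolding subalg_def using polys_scalar[of n]
    by (auto simp: saturation_def intro: * polys_add polys_mult)
qed

text \<open>
  The degree is written as that of a term \<open>t\<close>, so that multiplying by \<open>a\<^sub>0\<^sup>k\<close> turns it into the degree
  of \<open>a\<^sub>0\<^sup>k t\<close>; the other components of \<open>f\<close> are zero.
\<close>

lemma component_in_saturation:
  fixes S :: "'k::field mpoly set"
  assumes S: "graded_subalgebra n W S" and a0: "var 0 \<in> S"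
    and f: "f \<in> saturation n S"
  shows "component W (deg_pp W t) f \<in> saturation n S"
proof -
  have sub: "subalg scalars S" by (rule graded_subalgebra_subalg[OF S])
  obtain k where fP: "f \<in> polys n" and k: "var 0 ^ k * f \<in> S"
    using f by (auto simp: saturation_iff[OF sub a0])
  have "var 0 ^ k * component W (deg_pp W t) f \<in> S"
    using component_in_graded_subalgebra[OF S k]
    by (simp add: var_power flip: component_pp_times)
  moreover have "component W (deg_pp W t) f \<in> polys n"
    using fP by (auto simp: polys_def keys_component)
  ultimately show ?thesis by (auto simp: saturation_iff[OF sub a0])
qed

lemma graded_subalgebra_saturation:
  fixes S :: "'k::field mpoly set"
  assumes S: "graded_subalgebra n W S" and a0: "var 0 \<in> S"
  shows "graded_subalgebra n W (saturation n S)"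
proof -
  have sub: "subalg scalars (saturation n S)"
    by (rule subalg_saturation)
  define X where "X = {f \<in> saturation n S. homogeneous W f}"
  have "saturation n S \<subseteq> alg_gen X"
  proof
    fix f assume f: "f \<in> saturation n S"
    have "component W v f \<in> alg_gen X" if v: "v \<in> deg_pp W ` Poly_Mapping.keys f" for v
      using v component_in_saturation[OF S a0 f]
      by (auto simp: alg_gen_def X_def homogeneous_component intro!: hull_inc)
    then show "f \<in> alg_gen X"
      by (subst sum_components[of f W]) (rule subalg_sum[OF subalg_alg_gen])
  qed
  moreover have "alg_gen X \<subseteq> saturation n S"
    unfolding alg_gen_def by (rule hull_minimal) (auto simp: X_def sub)
  ultimately show ?thesis
    unfolding graded_subalgebra_def by (intro exI[of _ X]) (auto simp: X_def saturation_def)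
qed


section \<open>Leading terms\<close>

lemma LT_eqI:
  assumes "term_ordering n \<sigma>" "t \<in> Poly_Mapping.keys f" "\<And>s. s \<in> Poly_Mapping.keys f \<Longrightarrow> (s, t) \<in> \<sigma>"
  shows "LT \<sigma> f = t"
  unfolding LT_def
proof (rule the_equality)
  have "antisym \<sigma>"
    using assms(1) by (auto simp: term_ordering_def linear_order_on_def partial_order_on_def)
  then show "s = t" if "s \<in> Poly_Mapping.keys f \<and> (\<forall>r\<in>Poly_Mapping.keys f. (r, s) \<in> \<sigma>)" for s
    using that assms by (auto dest: antisymD)
qed (use assms in auto)

lemma LT_max:
  assumes ord: "term_ordering n \<sigma>" and f: "f \<in> polys n" "f \<noteq> 0"
  shows "LT \<sigma> f \<in> Poly_Mapping.keys f" "\<And>s. s \<in> Poly_Mapping.keys f \<Longrightarrow> (s, LT \<sigma> f) \<in> \<sigma>"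
proof -
  have tot: "total_on (terms n) \<sigma>" and refl: "refl_on (terms n) \<sigma>" and trans: "trans \<sigma>"
    using ord by (auto simp: term_ordering_def linear_order_on_def partial_order_on_def
        preorder_on_def)
  have "\<exists>t\<in>A. \<forall>s\<in>A. (s, t) \<in> \<sigma>" if "finite A" "A \<noteq> {}" "A \<subseteq> terms n" for A
    using that
  proof (induction A rule: finite_ne_induct)
    case (singleton x)
    then show ?case using refl by (auto dest: refl_onD)
  next
    case (insert x F)
    then obtain t where t: "t \<in> F" "\<forall>s\<in>F. (s, t) \<in> \<sigma>" by auto
    have xx: "(x, x) \<in> \<sigma>" using insert refl by (auto dest: refl_onD)
    have "(x, t) \<in> \<sigma> \<or> (t, x) \<in> \<sigma>"
      using tot insert.prems t insert.hyps by (auto simp: total_on_def)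
    then show ?case
    proof
      assume "(t, x) \<in> \<sigma>"
      then have "\<forall>s\<in>F. (s, x) \<in> \<sigma>" using t trans by (meson transD)
      then show ?thesis using xx by auto
    qed (use t in auto)
  qed
  then obtain t where t: "t \<in> Poly_Mapping.keys f" "\<forall>s\<in>Poly_Mapping.keys f. (s, t) \<in> \<sigma>"
    using f by (metis finite_keys keys_empty_iff polys_def mem_Collect_eq)
  then have "LT \<sigma> f = t" by (intro LT_eqI[OF ord]) auto
  with t show "LT \<sigma> f \<in> Poly_Mapping.keys f" "\<And>s. s \<in> Poly_Mapping.keys f \<Longrightarrow> (s, LT \<sigma> f) \<in> \<sigma>"
    by auto
qed

lemma LT_pp:
  assumes "term_ordering n \<sigma>" "u \<in> terms n"
  shows "LT \<sigma> (pp u :: 'k::field mpoly) = u"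
  using LT_max(1)[OF assms(1), of "pp u :: 'k mpoly"] assms(2) pp_neq_0
  by (auto simp: polys_def pp_def)

lemma LT_pp_times:
  assumes ord: "term_ordering n \<sigma>" and u: "u \<in> terms n" and f: "f \<in> polys n" "f \<noteq> 0"
  shows "LT \<sigma> (pp u * f) = u + LT \<sigma> f"
proof (rule LT_eqI[OF ord])
  show "u + LT \<sigma> f \<in> Poly_Mapping.keys (pp u * f)"
    using LT_max(1)[OF ord f] by (auto simp: keys_pp_times)
  fix s assume "s \<in> Poly_Mapping.keys (pp u * f)"
  then obtain r where "r \<in> Poly_Mapping.keys f" "s = u + r" by (auto simp: keys_pp_times)
  then show "(s, u + LT \<sigma> f) \<in> \<sigma>"
    using LT_max(2)[OF ord f] ord u unfolding term_ordering_def by (metis add.commute)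
qed

lemma deg_row1_eq:
  assumes "homogeneous W f" "t \<in> Poly_Mapping.keys f"
  shows "deg_row1 W f = deg_pp W t $ 0"
proof -
  define v where "v = deg_pp W t"
  have "deg_pp W s = v" if "s \<in> Poly_Mapping.keys f" for s
    using assms that unfolding homogeneous_def v_def by blast
  then have "(\<lambda>s. deg_pp W s $ 0) ` Poly_Mapping.keys f = {v $ 0}"
    using assms(2) by force
  then show ?thesis by (simp add: deg_row1_def v_def)
qed

text \<open>
  Among terms of equal degree, an ordering of \<open>a\<^sub>0\<close>-DegRev type prefers smaller exponents of \<open>a\<^sub>0\<close>.
\<close>

lemma LT_not_divisible_a0:
  assumes ord: "term_ordering n \<sigma>" and drl: "a0_DegRev_type n W \<sigma>"
    and f: "f \<in> polys n" "homogeneous W f"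
    and t: "t \<in> Poly_Mapping.keys f" "Poly_Mapping.lookup t 0 = 0"
  shows "Poly_Mapping.lookup (LT \<sigma> f) 0 = 0"
proof (rule ccontr)
  assume *: "Poly_Mapping.lookup (LT \<sigma> f) 0 \<noteq> 0"
  have f0: "f \<noteq> 0" using t by auto
  note LT = LT_max[OF ord f(1) f0]
  have "t \<in> terms n" "LT \<sigma> f \<in> terms n" using f(1) t(1) LT(1) by (auto simp: polys_def)
  moreover have "deg_pp W t = deg_pp W (LT \<sigma> f)"
    using f(2) t(1) LT(1) unfolding homogeneous_def by blast
  ultimately have "term_gt \<sigma> t (LT \<sigma> f)"
    using drl * t(2) unfolding a0_DegRev_type_def by simp
  then have "(LT \<sigma> f, t) \<in> \<sigma>" "t \<noteq> LT \<sigma> f" by (auto simp: term_gt_def)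
  moreover have "(t, LT \<sigma> f) \<in> \<sigma>" using LT(2) t(1) by auto
  moreover have "antisym \<sigma>"
    using ord by (auto simp: term_ordering_def linear_order_on_def partial_order_on_def)
  ultimately show False by (auto dest: antisymD)
qed


section \<open>Division by powers of the first indeterminate\<close>

lemma var0_dvd:
  fixes g :: "'k::field mpoly"
  assumes "\<And>t. t \<in> Poly_Mapping.keys g \<Longrightarrow> Poly_Mapping.lookup t 0 \<noteq> 0"
  shows "var 0 dvd g"
proof -
  have "var 0 dvd Poly_Mapping.single t (Poly_Mapping.lookup g t)" if "t \<in> Poly_Mapping.keys g" for t
  proof -
    have "t = Poly_Mapping.single 0 1 + (t - Poly_Mapping.single 0 1)"
      using assms[OF that]
      by (intro poly_mapping_eqI) (auto simp: lookup_add lookup_minus lookup_single when_def)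
    then have "Poly_Mapping.single t (Poly_Mapping.lookup g t)
        = var 0 * Poly_Mapping.single (t - Poly_Mapping.single 0 1) (Poly_Mapping.lookup g t)"
      by (simp add: var_def pp_def mult_single)
    then show ?thesis by simp
  qed
  then show ?thesis by (subst mpoly_as_sum[of g]) (rule dvd_sum)
qed

text \<open>
  For \<open>f \<noteq> 0\<close>, the exponents \<open>i\<close> with \<open>a\<^sub>0\<^sup>i\<close> dividing \<open>f\<close> are bounded by the exponent of \<open>a\<^sub>0\<close> in any
  term of \<open>f\<close>, so the greatest one exists; its maximality gives a term of the quotient without
  \<open>a\<^sub>0\<close>.
\<close>

lemma colon_a0:
  fixes f :: "'k::field mpoly"
  assumes "f \<noteq> 0"
  shows "f = var 0 ^ a0_power f * colon_a0 f"
    and "\<exists>t\<in>Poly_Mapping.keys (colon_a0 f). Poly_Mapping.lookup t 0 = 0"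
proof -
  obtain t where t: "t \<in> Poly_Mapping.keys f" using assms by (metis keys_empty_iff all_not_in_conv)
  have bound: "i \<le> Poly_Mapping.lookup t 0" if "var 0 ^ i dvd f" for i
  proof -
    from that obtain g where "f = pp (Poly_Mapping.single 0 i) * g"
      unfolding var_power by (rule dvdE)
    then show ?thesis using t by (auto simp: keys_pp_times lookup_add)
  qed
  have "var 0 ^ 0 dvd f" by simp
  from GreatestI_nat[of "\<lambda>i. var 0 ^ i dvd f", OF this] bound
  have "var 0 ^ a0_power f dvd f" unfolding a0_power_def by blast
  then obtain g where g: "f = var 0 ^ a0_power f * g" by (elim dvdE)
  have colon_eq: "colon_a0 f = g"
    unfolding colon_a0_def
  proof (rule the_equality)
    fix h assume "f = var 0 ^ a0_power f * h"
    with g have "var 0 ^ a0_power f * h = var 0 ^ a0_power f * g" by simp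
    then show "h = g" by (simp add: var_neq_0)
  qed (rule g)
  with g show "f = var 0 ^ a0_power f * colon_a0 f" by simp
  show "\<exists>t\<in>Poly_Mapping.keys (colon_a0 f). Poly_Mapping.lookup t 0 = 0"
  proof (rule ccontr)
    assume "\<not> ?thesis"
    then have "var 0 dvd g" unfolding colon_eq by (intro var0_dvd) auto
    then have "var 0 ^ a0_power f * var 0 dvd var 0 ^ a0_power f * g" by (rule mult_dvd_mono[OF dvd_refl])
    then have "var 0 ^ Suc (a0_power f) dvd f" by (simp only: power_Suc2 flip: g)
    then have "Suc (a0_power f) \<le> a0_power f"
      unfolding a0_power_def using bound by (rule Greatest_le_nat)
    then show False by simp
  qed
qed


section \<open>Truncated SAGBI bases of saturations\<close>

theorem proposition8p3:
  fixes n m :: nat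
    and \<delta> :: "nat \<Rightarrow> nat" and p :: "nat \<Rightarrow> int"
    and W :: "int mat" and \<sigma> :: "pprod rel"
    and S SB :: "'k::field mpoly set"
    and d :: nat
  assumes W_dim: "W \<in> carrier_mat m (Suc n)" "m \<ge> 2"
    and \<delta>_pos: "\<And>j. 1 \<le> j \<Longrightarrow> j \<le> n \<Longrightarrow> \<delta> j > 0"
    and W_row1: "row W 0 = vec (Suc n) (\<lambda>j. if j = 0 then 0 else int (\<delta> j))"
    and W_row2: "row W 1 = vec (Suc n) (\<lambda>j. if j = 0 then 1 else p j)"
    and \<sigma>_ord: "term_ordering n \<sigma>"
    and \<sigma>_compat: "compatible n W \<sigma>"
    and \<sigma>_DegRev: "a0_DegRev_type n W \<sigma>"
    and S_graded: "graded_subalgebra n W S"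
    and S_fg: "finitely_generated S"
    and a0_in: "var 0 \<in> S"
    and SB_basis: "sagbi_basis n \<sigma> S SB"
    and SB_homog: "\<And>g. g \<in> SB \<Longrightarrow> homogeneous W g"
    and d_pos: "d > 0"
  shows "truncated_sagbi_basis n W \<sigma> d (saturation n S)
           ({var 0} \<union> {colon_a0 g | g. g \<in> {g \<in> SB. homogeneous W g \<and> deg_row1 W g \<le> int d}})"
proof -
  \<comment> \<open>The \<open>W\<^sub>1\<close>-degree of a term: additive, never negative, and zero on powers of \<open>a\<^sub>0\<close>\<close>
  define w where "w t = deg_pp W t $ 0" for t
  define G where "G = {var 0} \<union> {colon_a0 g | g. g \<in> {g \<in> SB. homogeneous W g \<and> deg_row1 W g \<le> int d}}"
  define R where "R = LT_alg \<sigma> G"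
  have w_add: "w (s + t) = w s + w t" for s t
    using W_dim by (simp add: w_def deg_pp_add)
  have w_sum: "w t = (\<Sum>j<Suc n. (if j = 0 then 0 else int (\<delta> j)) * int (Poly_Mapping.lookup t j))" for t
    using W_dim W_row1 by (simp add: w_def deg_pp_def scalar_prod_def atLeast0LessThan)
  have w_nonneg: "0 \<le> w t" for t
    unfolding w_sum by (intro sum_nonneg) auto
  have w_a0: "w (Poly_Mapping.single 0 k) = 0" for k
    unfolding w_sum by (intro sum.neutral) (auto simp: lookup_single when_def)
  have S: "subalg scalars S" and S_polys: "S \<subseteq> polys n"
    and SB: "SB \<subseteq> S - {0}" and SB_LT: "LT_alg \<sigma> (S - {0}) = LT_alg \<sigma> SB"
    using SB_basis by (auto simp: sagbi_basis_def subalgebra_of_polys_def)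
  note sat = saturation_iff[OF S a0_in]
  have deg_row1: "deg_row1 W f = w (LT \<sigma> f)" if "f \<in> polys n" "f \<noteq> 0" "homogeneous W f"
    for f :: "'k mpoly"
    using deg_row1_eq that LT_max(1)[OF \<sigma>_ord] by (auto simp: w_def)
  have LT_a0: "LT \<sigma> (var 0 ^ k * f) = Poly_Mapping.single 0 k + LT \<sigma> f"
    if "f \<in> polys n" "f \<noteq> 0" for k and f :: "'k mpoly"
    unfolding var_power by (rule LT_pp_times[OF \<sigma>_ord terms_single_0 that])

  have a0_sat: "var 0 \<in> saturation n S"
    unfolding sat using a0_in by (auto intro: var0_in_polys exI[of _ 0])
  have a0_homog: "homogeneous W (var 0)" by (simp add: var_def homogeneous_pp)
  have LT_var0: "LT \<sigma> (var 0 :: 'k mpoly) = Poly_Mapping.single 0 1"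
    unfolding var_def by (rule LT_pp[OF \<sigma>_ord terms_single_0])
  have a0_deg: "deg_row1 W (var 0 :: 'k mpoly) = 0"
    by (simp only: deg_row1[OF var0_in_polys var_neq_0 a0_homog] LT_var0 w_a0)

  have colon: "g = var 0 ^ a0_power g * colon_a0 g" "colon_a0 g \<noteq> 0" "colon_a0 g \<in> polys n"
    "colon_a0 g \<in> saturation n S" "homogeneous W (colon_a0 g)"
    "LT \<sigma> g = Poly_Mapping.single 0 (a0_power g) + LT \<sigma> (colon_a0 g)"
    "deg_row1 W (colon_a0 g) = deg_row1 W g"
    "Poly_Mapping.lookup (LT \<sigma> (colon_a0 g)) 0 = 0" if g: "g \<in> SB" for g
  proof -
    have g': "g \<noteq> 0" "g \<in> S" "g \<in> polys n" using g SB S_polys by auto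
    show eq: "g = var 0 ^ a0_power g * colon_a0 g" using colon_a0(1) g' by blast
    then show nz: "colon_a0 g \<noteq> 0" using g' by auto
    show po: "colon_a0 g \<in> polys n"
      using g'(3) polys_pp_times_cancel eq by (metis var_power)
    show "colon_a0 g \<in> saturation n S"
      unfolding sat using po eq g' by metis
    show ho: "homogeneous W (colon_a0 g)"
      using SB_homog[OF g] homogeneous_pp_times_iff eq by (metis var_power)
    show LT: "LT \<sigma> g = Poly_Mapping.single 0 (a0_power g) + LT \<sigma> (colon_a0 g)"
      using LT_a0[OF po nz] eq by metis
    show "deg_row1 W (colon_a0 g) = deg_row1 W g"
      using deg_row1[OF po nz ho] deg_row1[OF g'(3,1) SB_homog[OF g]] LT
      by (simp add: w_add w_a0)
    show "Poly_Mapping.lookup (LT \<sigma> (colon_a0 g)) 0 = 0"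
      using colon_a0(2)[OF g'(1)] LT_not_divisible_a0[OF \<sigma>_ord \<sigma>_DegRev po ho] by blast
  qed

  have R: "subalg scalars R" unfolding R_def LT_alg_def by (rule subalg_alg_gen)
  have R_LT: "pp (LT \<sigma> g) \<in> R" if "g \<in> G" for g
    unfolding R_def LT_alg_def alg_gen_def using that by (intro hull_inc) auto

  \<comment> \<open>A product of terms \<open>LT(g)\<close> has all its factors of degree at most \<open>d\<close> if it has itself; replacing
    each \<open>g\<close> by \<open>g : a\<^sub>0\<^sup>\<infinity>\<close> collects the powers of \<open>a\<^sub>0\<close> in one factor and leaves a cofactor
    prime to \<open>a\<^sub>0\<close>.\<close>
  have factor: "\<exists>e s. t = Poly_Mapping.single 0 e + s \<and> Poly_Mapping.lookup s 0 = 0 \<and> pp s \<in> R"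
    if "t \<in> add_span (LT \<sigma> ` SB)" "w t \<le> int d" for t
    using that
  proof (induction rule: add_span.induct)
    case zero
    have "pp 0 \<in> R" using subalg_const[OF R one_in_scalars] by (simp add: pp_0)
    then show ?case by (intro exI[of _ 0]) auto
  next
    case (add h x)
    then obtain g where g: "g \<in> SB" "h = LT \<sigma> g" by auto
    have le: "w x \<le> int d" "w h \<le> int d"
      using add.prems w_nonneg[of x] w_nonneg[of h] by (auto simp: w_add)
    then obtain e s where x: "x = Poly_Mapping.single 0 e + s" "Poly_Mapping.lookup s 0 = 0" "pp s \<in> R"
      using add.IH by blast
    have "g \<in> polys n" "g \<noteq> 0" using g SB S_polys by auto
    then have "deg_row1 W g \<le> int d"
      using le g deg_row1[OF _ _ SB_homog[OF g(1)]] by simp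
    then have "colon_a0 g \<in> G" using g SB_homog by (auto simp: G_def)
    then have "pp (LT \<sigma> (colon_a0 g) + s) \<in> R"
      using R_LT x by (simp add: pp_add subalg_mult[OF R])
    moreover have "h + x = Poly_Mapping.single 0 (a0_power g + e) + (LT \<sigma> (colon_a0 g) + s)"
      using g colon(6)[OF g(1)] x by (simp add: single_add algebra_simps)
    moreover have "Poly_Mapping.lookup (LT \<sigma> (colon_a0 g) + s) 0 = 0"
      using x colon(8)[OF g(1)] by (simp add: lookup_add)
    ultimately show ?case by blast
  qed

  have main: "pp (LT \<sigma> f) \<in> R"
    if f: "f \<in> saturation n S" "f \<noteq> 0" "homogeneous W f" "deg_row1 W f \<le> int d" for f
  proof -
    obtain k where fP: "f \<in> polys n" and k: "var 0 ^ k * f \<in> S" using f(1) by (auto simp: sat)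
    have LT_image: "{pp (LT \<sigma> g) | g. g \<in> A} = pp ` LT \<sigma> ` A" for A :: "'k mpoly set"
      by auto
    have "var 0 ^ k * f \<in> S - {0}" using k f(2) by (simp add: var_neq_0)
    then have "pp (LT \<sigma> (var 0 ^ k * f)) \<in> LT_alg \<sigma> (S - {0})"
      unfolding LT_alg_def alg_gen_def by (intro hull_inc) auto
    then have "(pp (LT \<sigma> (var 0 ^ k * f)) :: 'k mpoly) \<in> alg_gen (pp ` LT \<sigma> ` SB)"
      unfolding SB_LT by (simp only: LT_alg_def LT_image)
    then have "Poly_Mapping.single 0 k + LT \<sigma> f \<in> add_span (LT \<sigma> ` SB)"
      using LT_a0[OF fP f(2)] by (auto dest: pp_in_alg_gen_imp)
    moreover have "w (Poly_Mapping.single 0 k + LT \<sigma> f) \<le> int d"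
      using f(4) deg_row1[OF fP f(2,3)] by (simp add: w_add w_a0)
    ultimately obtain e s where es: "Poly_Mapping.single 0 k + LT \<sigma> f = Poly_Mapping.single 0 e + s"
      "Poly_Mapping.lookup s 0 = 0" "pp s \<in> R"
      using factor by blast
    \<comment> \<open>As \<open>s\<close> is prime to \<open>a\<^sub>0\<close>, the exponents of \<open>a\<^sub>0\<close> show \<open>k \<le> e\<close>, so \<open>a\<^sub>0\<^sup>k\<close> cancels.\<close>
    have "k + Poly_Mapping.lookup (LT \<sigma> f) 0 = e"
      using arg_cong[OF es(1), of "\<lambda>t. Poly_Mapping.lookup t 0"] es(2) by (simp add: lookup_add)
    then have "Poly_Mapping.single 0 e = Poly_Mapping.single 0 k + Poly_Mapping.single (0::nat) (e - k)"
      by (auto simp flip: single_add)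
    then have "LT \<sigma> f = Poly_Mapping.single 0 (e - k) + s"
      using es(1) by (simp add: add.assoc)
    then have LT_f: "pp (LT \<sigma> f) = (var 0 ^ (e - k) * pp s :: 'k mpoly)"
      by (simp add: pp_add var_power)
    have "(pp (LT \<sigma> (var 0 :: 'k mpoly)) :: 'k mpoly) \<in> R" by (rule R_LT) (simp add: G_def)
    then have "(var 0 :: 'k mpoly) \<in> R" unfolding LT_var0 by (simp add: var_def)
    then show ?thesis
      unfolding LT_f using es(3) by (intro subalg_mult[OF R] subalg_power[OF R one_in_scalars])
  qed

  have "truncated_sagbi_basis n W \<sigma> d (saturation n S) G"
    unfolding truncated_sagbi_basis_def
  proof (intro conjI ballI impI)
    show "graded_subalgebra n W (saturation n S)"
      by (rule graded_subalgebra_saturation[OF S_graded a0_in])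
    show "G \<subseteq> saturation n S - {0}"
      using colon(2,4) a0_sat by (auto simp: G_def var_neq_0)
    show "homogeneous W g" "deg_row1 W g \<le> int d" if "g \<in> G" for g
      using that colon(5,7) a0_homog a0_deg by (auto simp: G_def)
    show "pp (LT \<sigma> f) \<in> LT_alg \<sigma> G"
      if "f \<in> saturation n S - {0}" "homogeneous W f \<and> deg_row1 W f \<le> int d" for f
      using main that by (auto simp: R_def)
  qed
  then show ?thesis unfolding G_def .
qed

end
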